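(* Let $n\ge 2$. As a representation over the field $F_{\Lambda'}$, the representation $\rho^0_{LK}$ on the $F_{\Lambda'}$-vector space with basis $u_0,\dots,u_{n-1}$, given by the operators $X_0^{\pm1},X_1^{\pm1},E_0,E_1$ in the context, is irreducible.
   Context: Notation: $\Lambda'$ is the localization of $\mathbb{Q}[v_0^{\pm1},v_1^{\pm1},l_0^{\pm1},l_1^{\pm1}]$ at $m_0,m_1$, where $m_i=v_i-v_i^{-1}$; $F_{\Lambda'}$ is its field of fractions; $\tau_i=\frac{l_i-l_i^{-1}}{m_i}+1$. Sequences: $a_0=b_0=1$, $a_1=m_1$, $b_1=m_0$; $b_{2i}=-v_0^{-1}a_{2i-1}$ and $a_{2i}=b_{2i}$ for $i\ge1$; $a_{2i+1}=m_1b_{2i}+b_{2i-1}$ for $i\ge1$; $b_{2i-1}=m_0a_{2i-2}+a_{2i-3}$ for $i\ge2$. Constants: $\lambda_{2i+1}=\frac{m_1}{m_0}(v_0^{-1}+l_0^{-1})$ for $i$ even, $\lambda_{2i+1}=v_0^{-1}+l_0^{-1}$ for $i$ odd ($i\ge0$). Operators of $\rho^0_{LK}$ (indices $j<n-1$ in the first two lines): $X_0u_0=l_0u_0$; $X_0u_{2i-1}=u_{2i}$; $X_0u_{2i}=m_0l_0\lambda_{2i-1}u_0+u_{2i-1}-m_0u_{2i}$ ($i\ge1$). $X_1u_{2i}=u_{2i+1}$ ($i\ge0$); $X_1u_{2i-1}=u_{2i-2}-m_1u_{2i-1}$ ($i\ge1$). For $n$ even: $X_0u_{n-1}=\sum_{i=0}^{n-1}v_0^{-1}a_{n-1-i}u_i$,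 $X_1u_{n-1}=u_{n-2}-m_1u_{n-1}$. For $n$ odd: $X_0u_{n-1}=m_0l_0\lambda_{n-2}u_0+u_{n-2}-m_0u_{n-1}$, $X_1u_{n-1}=\sum_{i=0}^{n-1}v_0^{-1}b_{n-1-i}u_i$. $E_0u_0=\tau_0u_0$; $E_0u_{2i-1}=\lambda_{2i-1}u_0$; $E_0u_{2i}=l_0\lambda_{2i-1}u_0$ ($i\ge1$); $E_1u_i=0$ for all $i$. Irreducible means: there is no proper nonzero $F_{\Lambda'}$-subspace stable under all these operators. *)

theory Defs
  imports
    "HOL-Computational_Algebra.Fraction_Field"
    "Jordan_Normal_Form.VS_Connect"
    "Jordan_Normal_Form.Gauss_Jordan_Elimination"
begin

text \<open>
  The ring \<open>\<Lambda>'\<close> is obtained from the polynomial ring \<open>\<rat>[v\<^sub>0, v\<^sub>1, l\<^sub>0, l\<^sub>1]\<close> by inverting the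
  four indeterminates and the two nonzero elements \<open>v\<^sub>i - v\<^sub>i\<^sup>-\<^sup>1\<close>; hence its field of fractions is the
  field of fractions of that polynomial ring, the rational function field \<open>\<rat>(v\<^sub>0, v\<^sub>1, l\<^sub>0, l\<^sub>1)\<close>.
  The polynomial ring is encoded by iterated univariate polynomials, with \<open>v\<^sub>0\<close> the
  innermost and \<open>l\<^sub>1\<close> the outermost indeterminate.
\<close>

type_synonym FLambda = "rat poly poly poly poly fract"

definition v0 :: FLambda where "v0 = Fract [:[:[:[:0, 1:]:]:]:] 1"
definition v1 :: FLambda where "v1 = Fract [:[:[:0, 1:]:]:] 1"
definition l0 :: FLambda where "l0 = Fract [:[:0, 1:]:] 1"
definition l1 :: FLambda where "l1 = Fract [:0, 1:] 1"

definition m0 :: FLambda where "m0 = v0 - inverse v0"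
definition m1 :: FLambda where "m1 = v1 - inverse v1"

definition tau0 :: FLambda where "tau0 = (l0 - inverse l0) / m0 + 1"

fun a_seq b_seq :: "nat \<Rightarrow> FLambda" where
  "a_seq 0 = 1"
| "a_seq (Suc 0) = m1"
| "a_seq (Suc (Suc k)) =
     (if even k then b_seq (Suc (Suc k)) else m1 * b_seq (Suc k) + b_seq k)"
| "b_seq 0 = 1"
| "b_seq (Suc 0) = m0"
| "b_seq (Suc (Suc k)) =
     (if even k then - inverse v0 * a_seq (Suc k) else m0 * a_seq (Suc k) + a_seq k)"

text \<open>Only odd arguments \<open>k = 2 i + 1\<close> are meaningful; then \<open>k div 2 = i\<close>.\<close>

definition lam :: "nat \<Rightarrow> FLambda" where
  "lam k = (if even (k div 2) then m1 / m0 * (inverse v0 + inverse l0)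
            else inverse v0 + inverse l0)"

text \<open>
  The representation space is \<open>carrier_vec n\<close> with \<open>u\<^sub>j = unit_vec n j\<close> for \<open>j < n\<close>. The functions
  \<open>X0_on n j\<close>, \<open>X1_on n j\<close>, \<open>E0_on n j\<close> give the images of \<open>u\<^sub>j\<close> (for \<open>n \<ge> 2\<close>); in the special
  columns, \<open>vec n c\<close> is the linear combination of the \<open>u\<^sub>i\<close> with coefficients \<open>c i\<close>. Since the
  index \<open>n - 1\<close> is odd exactly if \<open>n\<close> is even, the special column of \<open>X\<^sub>0\<close> occurs
  only for even \<open>n\<close> and that of \<open>X\<^sub>1\<close> only for odd \<open>n\<close>.
\<close>

definition X0_on :: "nat \<Rightarrow> nat \<Rightarrow> FLambda vec" where
  "X0_on n j =
    (if j = 0 then l0 \<cdot>\<^sub>v unit_vec n 0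
     else if odd j then
       (if j = n - 1 then vec n (\<lambda>i. inverse v0 * a_seq (n - 1 - i))
        else unit_vec n (j + 1))
     else (m0 * l0 * lam (j - 1)) \<cdot>\<^sub>v unit_vec n 0 + unit_vec n (j - 1) - m0 \<cdot>\<^sub>v unit_vec n j)"

definition X1_on :: "nat \<Rightarrow> nat \<Rightarrow> FLambda vec" where
  "X1_on n j =
    (if even j then
       (if j = n - 1 then vec n (\<lambda>i. inverse v0 * b_seq (n - 1 - i))
        else unit_vec n (j + 1))
     else unit_vec n (j - 1) - m1 \<cdot>\<^sub>v unit_vec n j)"

definition E0_on :: "nat \<Rightarrow> nat \<Rightarrow> FLambda vec" where
  "E0_on n j =
    (if j = 0 then tau0 \<cdot>\<^sub>v unit_vec n 0
     else if odd j then lam j \<cdot>\<^sub>v unit_vec n 0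
     else (l0 * lam (j - 1)) \<cdot>\<^sub>v unit_vec n 0)"

definition X0 :: "nat \<Rightarrow> FLambda mat" where "X0 n = mat_of_cols n (map (X0_on n) [0..<n])"
definition X1 :: "nat \<Rightarrow> FLambda mat" where "X1 n = mat_of_cols n (map (X1_on n) [0..<n])"
definition E0 :: "nat \<Rightarrow> FLambda mat" where "E0 n = mat_of_cols n (map (E0_on n) [0..<n])"
definition E1 :: "nat \<Rightarrow> FLambda mat" where "E1 n = 0\<^sub>m n n"

text \<open>\<open>the (mat_inverse A)\<close> is the inverse of \<open>A\<close> only if \<open>A\<close> is invertible.\<close>

definition rho_LK :: "nat \<Rightarrow> FLambda mat set" where
  "rho_LK n = {X0 n, the (mat_inverse (X0 n)), X1 n, the (mat_inverse (X1 n)), E0 n, E1 n}"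

definition irreducible_under :: "nat \<Rightarrow> 'a::field mat set \<Rightarrow> bool" where
  "irreducible_under n S \<longleftrightarrow>
    \<not> (\<exists>W. subspace class_ring W (module_vec TYPE('a) n) \<and>
           W \<noteq> {0\<^sub>v n} \<and> W \<noteq> carrier_vec n \<and>
           (\<forall>A\<in>S. \<forall>w\<in>W. A *\<^sub>v w \<in> W))"

end

theory Submission
  imports Defs
begin

text \<open>
  Both claims reduce to a degenerate case by specialising the parameters. At \<open>v\<^sub>0 = v\<^sub>1 = 1\<close> both
  \<open>m\<^sub>i\<close> vanish, all \<open>a\<^sub>k\<close> and \<open>b\<^sub>k\<close> with \<open>k \<ge> 1\<close> vanish, and although \<open>\<lambda>\<^sub>k\<close> has \<open>m\<^sub>0\<close> in the
  denominator for some \<open>k\<close>, the products \<open>m\<^sub>0 l\<^sub>0 \<lambda>\<^sub>k\<close> that occur in \<open>X\<^sub>0\<close> vanish too. What is left of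
  \<open>X\<^sub>1\<close> exchanges \<open>u\<^sub>0 \<leftrightarrow> u\<^sub>1\<close>, \<open>u\<^sub>2 \<leftrightarrow> u\<^sub>3\<close>, \<dots>, while \<open>X\<^sub>0\<close> multiplies \<open>u\<^sub>0\<close> by \<open>l\<^sub>0\<close> and exchanges
  \<open>u\<^sub>1 \<leftrightarrow> u\<^sub>2\<close>, \<open>u\<^sub>3 \<leftrightarrow> u\<^sub>4\<close>, \<dots>; an index without a partner is fixed. A determinant that is nonzero
  after specialisation is nonzero, so at \<open>l\<^sub>0 = 1\<close> the invertibility of \<open>X\<^sub>0\<close> and \<open>X\<^sub>1\<close> follows.

  For irreducibility, let \<open>W\<close> be an invariant subspace. Every value of \<open>E\<^sub>0\<close> is a multiple of \<open>u\<^sub>0\<close>,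
  say \<open>E\<^sub>0 w = \<phi>(w) u\<^sub>0\<close>. If \<open>\<phi>\<close> does not vanish on \<open>W\<close>, then \<open>W\<close> contains \<open>u\<^sub>0\<close>, and applying \<open>X\<^sub>1\<close> and
  \<open>X\<^sub>0\<close> alternately produces all \<open>u\<^sub>j\<close> (\<open>unit_vec_in_invariant\<close>).

  If \<open>\<phi>\<close> vanishes on \<open>W\<close>, then so do the functionals \<open>\<phi>\<close>, \<open>\<phi> X\<^sub>1\<close>, \<open>\<phi> X\<^sub>1 X\<^sub>0\<close>, \<open>\<phi> X\<^sub>1 X\<^sub>0 X\<^sub>1\<close>, \<dots>.
  The first \<open>n\<close> of them are linearly independent: after multiplication by \<open>- m\<^sub>0 l\<^sub>0\<close> they specialise,
  at \<open>v\<^sub>0 = v\<^sub>1 = 1\<close> and \<open>l\<^sub>0 = 0\<close>, to the coordinate functionals of \<open>u\<^sub>0, u\<^sub>1, u\<^sub>2, \<dots>\<close>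
  (\<open>specialises_probe\<close>), since the degenerate \<open>X\<^sub>1\<close> and \<open>X\<^sub>0\<close> carry each coordinate to the next.
  Hence \<open>W = 0\<close> (\<open>probes_separate\<close>).
\<close>

section \<open>Specialisation of rational functions\<close>

text \<open>The value of a polynomial at \<open>v\<^sub>0 = v\<^sub>1 = 1\<close>, \<open>l\<^sub>0 = c\<close>, \<open>l\<^sub>1 = 0\<close>, starting with the outermost
  indeterminate \<open>l\<^sub>1\<close>. Two values of \<open>c\<close> are needed: the functionals
  degenerate to coordinates at \<open>c = 0\<close>, where however \<open>X\<^sub>0\<close> becomes singular.\<close>

definition eval_num :: "rat \<Rightarrow> rat poly poly poly poly \<Rightarrow> rat" where
  "eval_num c p = poly (poly (poly (poly p 0) [:[:c:]:]) 1) 1"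

text \<open>The graph of the specialisation map from the local ring of the point into \<open>\<rat>\<close>. As a relation it
  expresses definedness and value at once; closure under the ring operations is all that determinants
  require, and \<open>specialises_zeroD\<close> transfers non-vanishing back.\<close>

definition specialises :: "rat \<Rightarrow> FLambda \<Rightarrow> rat \<Rightarrow> bool" where
  "specialises c x q \<longleftrightarrow>
     (\<exists>p d. x = Fract p d \<and> eval_num c d \<noteq> 0 \<and> q = eval_num c p / eval_num c d)"

lemma eval_num_simps [simp]:
  "eval_num c 0 = 0" "eval_num c 1 = 1"
  "eval_num c (p + p') = eval_num c p + eval_num c p'"
  "eval_num c (- p) = - eval_num c p"
  "eval_num c (p * p') = eval_num c p * eval_num c p'"
  by (simp_all add: eval_num_def)

lemma eval_num_nonzeroD: "eval_num c d \<noteq> 0 \<Longrightarrow> d \<noteq> 0"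
  by auto

lemma specialises_zeroD: "specialises c 0 q \<Longrightarrow> q = 0"
  by (auto simp: specialises_def Zero_fract_def eq_fract dest!: eval_num_nonzeroD)

lemma specialises_Fract_one: "specialises c (Fract p 1) (eval_num c p)"
  unfolding specialises_def by (intro exI[of _ p] exI[of _ 1]) simp

lemma specialises_0: "specialises c 0 0"
  using specialises_Fract_one[of c 0] by (simp add: Zero_fract_def)

lemma specialises_1: "specialises c 1 1"
  using specialises_Fract_one[of c 1] by (simp add: One_fract_def)

lemma specialises_v0: "specialises c v0 1"
  and specialises_v1: "specialises c v1 1"
  and specialises_l0: "specialises c l0 c"
  using specialises_Fract_one[of c "[:[:[:[:0, 1:]:]:]:]"]
    specialises_Fract_one[of c "[:[:[:0, 1:]:]:]"]
    specialises_Fract_one[of c "[:[:0, 1:]:]"]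
  by (simp_all add: v0_def v1_def l0_def eval_num_def)

lemma specialises_add:
  assumes "specialises c x q" "specialises c y r"
  shows "specialises c (x + y) (q + r)"
proof -
  from assms obtain p d p' d' where
    "x = Fract p d" "eval_num c d \<noteq> 0" "q = eval_num c p / eval_num c d"
    "y = Fract p' d'" "eval_num c d' \<noteq> 0" "r = eval_num c p' / eval_num c d'"
    unfolding specialises_def by blast
  then show ?thesis
    unfolding specialises_def
    by (intro exI[of _ "p * d' + p' * d"] exI[of _ "d * d'"])
      (auto simp: add_frac_eq dest!: eval_num_nonzeroD)
qed

lemma specialises_mult:
  assumes "specialises c x q" "specialises c y r"
  shows "specialises c (x * y) (q * r)"
proof -
  from assms obtain p d p' d' where
    "x = Fract p d" "eval_num c d \<noteq> 0" "q = eval_num c p / eval_num c d"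
    "y = Fract p' d'" "eval_num c d' \<noteq> 0" "r = eval_num c p' / eval_num c d'"
    unfolding specialises_def by blast
  then show ?thesis
    unfolding specialises_def
    by (intro exI[of _ "p * p'"] exI[of _ "d * d'"]) auto
qed

lemma specialises_minus:
  assumes "specialises c x q"
  shows "specialises c (- x) (- q)"
  using assms specialises_mult[OF specialises_Fract_one[of c "- 1"] assms]
  by (simp add: minus_fract[symmetric] One_fract_def[symmetric])

lemma specialises_diff:
  "specialises c x q \<Longrightarrow> specialises c y r \<Longrightarrow> specialises c (x - y) (q - r)"
  using specialises_add[of c x q "- y" "- r"] specialises_minus by simp

lemma specialises_inverse:
  assumes "specialises c x q" "q \<noteq> 0"
  shows "specialises c (inverse x) (inverse q)"
proof -
  from assms obtain p d where
    "x = Fract p d" "eval_num c d \<noteq> 0" "q = eval_num c p / eval_num c d"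
    unfolding specialises_def by blast
  then show ?thesis
    using assms(2) unfolding specialises_def
    by (intro exI[of _ d] exI[of _ p]) auto
qed

lemma specialises_sum:
  "(\<And>i. i \<in> A \<Longrightarrow> specialises c (f i) (g i)) \<Longrightarrow> specialises c (sum f A) (sum g A)"
  by (induction A rule: infinite_finite_induct) (auto intro: specialises_0 specialises_add)

lemma specialises_prod:
  "(\<And>i. i \<in> A \<Longrightarrow> specialises c (f i) (g i)) \<Longrightarrow> specialises c (prod f A) (prod g A)"
  by (induction A rule: infinite_finite_induct) (auto intro: specialises_1 specialises_mult)

lemma specialises_det:
  assumes "\<And>i j. i < n \<Longrightarrow> j < n \<Longrightarrow> specialises c (f i j) (g i j)"
  shows "specialises c (det (mat n n (\<lambda>(i, j). f i j))) (det (mat n n (\<lambda>(i, j). g i j)))"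
proof -
  have "specialises c (signof p) (signof p)" for p
    using specialises_minus[OF specialises_1] by (auto simp: sign_def intro: specialises_1)
  moreover have "p i < n" if "p permutes {0..<n}" "i < n" for p i
    using that permutes_in_image[OF that(1), of i] by simp
  ultimately show ?thesis
    unfolding det_def'[OF mat_carrier]
    by (intro specialises_sum specialises_mult specialises_prod) (simp_all add: assms)
qed

lemma specialises_m0: "specialises c m0 0"
  and specialises_m1: "specialises c m1 0"
  using specialises_diff[OF specialises_v0 specialises_inverse[OF specialises_v0]]
    specialises_diff[OF specialises_v1 specialises_inverse[OF specialises_v1]]
  by (simp_all add: m0_def m1_def)

lemma specialises_inverse_v0: "specialises c (inverse v0) 1"
  using specialises_inverse[OF specialises_v0] by simp

lemma m0_nonzero: "m0 \<noteq> 0"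
proof
  assume "m0 = 0"
  moreover have "v0 \<noteq> 0"
    using specialises_v0[of 0] specialises_zeroD[of 0 1] by auto
  ultimately have "v0 * v0 = 1"
    by (simp add: m0_def field_simps)
  then show False
    by (simp add: v0_def One_fract_def eq_fract one_pCons)
qed

lemma l0_nonzero: "l0 \<noteq> 0"
  using specialises_l0[of 1] specialises_zeroD[of 1 1] by auto

text \<open>The factor \<open>m\<^sub>0\<close> clears the denominator of \<open>\<lambda>\<^sub>k\<close> for even \<open>k div 2\<close>, which vanishes at the point, and
  \<open>l\<^sub>0\<close> clears \<open>l\<^sub>0\<^sup>-\<^sup>1\<close>, so that \<open>l\<^sub>0 = 0\<close> is admissible.\<close>

lemma m0_l0_lam:
  "m0 * l0 * lam k = (if even (k div 2) then m1 else m0) * (inverse v0 * l0 + 1)"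
  using m0_nonzero l0_nonzero by (simp add: lam_def field_simps)

lemma specialises_m0_l0_lam: "specialises c (m0 * l0 * lam k) 0"
proof -
  have "specialises c ((if even (k div 2) then m1 else m0) * (inverse v0 * l0 + 1)) (0 * (1 * c + 1))"
    by (intro specialises_mult specialises_add)
       (auto intro: specialises_m0 specialises_m1 specialises_inverse_v0 specialises_l0 specialises_1)
  then show ?thesis by (simp add: m0_l0_lam)
qed

text \<open>With \<open>m\<^sub>0 = m\<^sub>1 = 0\<close> each of the recursions only passes on, up to sign, earlier terms of odd
  index, and \<open>a\<^sub>1 = b\<^sub>1 = 0\<close>.\<close>

lemma specialises_seq:
  "specialises c (a_seq k) (if k = 0 then 1 else 0)"
  "specialises c (b_seq k) (if k = 0 then 1 else 0)"
proof (induction k and k rule: a_seq_b_seq.induct)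
  case (3 k)
  then have "specialises c (m1 * b_seq (Suc k) + b_seq k) (0 * 0 + 0)" if "odd k"
    using that by (intro specialises_add specialises_mult specialises_m1) (auto split: if_splits)
  with 3 show ?case by auto
next
  case (6 k)
  then have "specialises c (m0 * a_seq (Suc k) + a_seq k) (0 * 0 + 0)" if "odd k"
    using that by (intro specialises_add specialises_mult specialises_m0) (auto split: if_splits)
  moreover from 6 have "specialises c (- inverse v0 * a_seq (Suc k)) (- 1 * 0)" if "even k"
    using that by (intro specialises_mult specialises_minus specialises_inverse_v0) auto
  ultimately show ?case by auto
qed (auto intro: specialises_1 specialises_m0 specialises_m1)

section \<open>The generators at the special point\<close>

text \<open>The involutions of \<open>{0..<n}\<close> by which the degenerate \<open>X\<^sub>0\<close> and \<open>X\<^sub>1\<close> permute the basis, up to the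
  factor \<open>l\<^sub>0\<close> at \<open>u\<^sub>0\<close>. In \<open>partner0\<close>, truncated subtraction makes \<open>0\<close> a fixed point.\<close>

definition partner0 :: "nat \<Rightarrow> nat \<Rightarrow> nat" where
  "partner0 n i = (if odd i then if i = n - 1 then i else i + 1 else i - 1)"

definition partner1 :: "nat \<Rightarrow> nat \<Rightarrow> nat" where
  "partner1 n i = (if even i then if i = n - 1 then i else i + 1 else i - 1)"

lemma partner_involution:
  assumes "i < n"
  shows "partner0 n i < n" "partner0 n (partner0 n i) = i"
    "partner1 n i < n" "partner1 n (partner1 n i) = i"
  using assms by (auto simp: partner0_def partner1_def; presburger)+

lemma X_carrier [simp]:
  "X0 n \<in> carrier_mat n n" "X1 n \<in> carrier_mat n n" "E0 n \<in> carrier_mat n n"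
  by (auto simp: X0_def X1_def E0_def)

lemmas X_dims [simp] = X_carrier [THEN carrier_matD(1)] X_carrier [THEN carrier_matD(2)]

lemma X_index:
  assumes "k < n" "i < n"
  shows "X0 n $$ (k, i) = X0_on n i $ k" "X1 n $$ (k, i) = X1_on n i $ k"
    "E0 n $$ (k, i) = E0_on n i $ k"
  using assms by (auto simp: X0_def X1_def E0_def mat_of_cols_index)

lemma specialises_indicator: "specialises c (if P then 1 else 0) (if P then 1 else 0)"
  by (auto intro: specialises_0 specialises_1)

lemma specialises_X0:
  assumes "k < n" "i < n"
  shows "specialises c (X0 n $$ (k, i)) (if k = partner0 n i then if i = 0 then c else 1 else 0)"
proof -
  consider "i = 0" | "odd i" "i = n - 1" | "odd i" "i \<noteq> n - 1" | "even i" "i \<noteq> 0" by blast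
  then show ?thesis
  proof cases
    case 1
    with assms show ?thesis
      by (auto simp: X_index X0_on_def partner0_def intro: specialises_0 specialises_l0)
  next
    case 2
    have "specialises c (inverse v0 * a_seq (n - 1 - k)) (1 * (if n - 1 - k = 0 then 1 else 0))"
      by (intro specialises_mult specialises_inverse_v0 specialises_seq)
    moreover from 2 have "i \<noteq> 0"
      using odd_pos by blast
    ultimately show ?thesis
      using 2 assms by (auto simp: X_index X0_on_def partner0_def split: if_splits)
  next
    case 3
    with assms show ?thesis
      by (auto simp: X_index X0_on_def partner0_def intro: specialises_0 specialises_1)
  next
    case 4
    let ?d = "\<lambda>j. if k = j then 1 else 0"
    have "specialises c (m0 * l0 * lam (i - 1) * ?d 0 + ?d (i - 1) - m0 * ?d i)
        (0 * ?d 0 + ?d (i - 1) - 0 * ?d i)"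
      by (intro specialises_add specialises_diff specialises_mult[OF specialises_m0_l0_lam]
          specialises_mult[OF specialises_m0] specialises_indicator)
    with 4 assms show ?thesis
      by (auto simp: X_index X0_on_def partner0_def)
  qed
qed

lemma specialises_X1:
  assumes "k < n" "i < n"
  shows "specialises c (X1 n $$ (k, i)) (if k = partner1 n i then 1 else 0)"
proof -
  consider "even i" "i = n - 1" | "even i" "i \<noteq> n - 1" | "odd i" by blast
  then show ?thesis
  proof cases
    case 1
    have "specialises c (inverse v0 * b_seq (n - 1 - k)) (1 * (if n - 1 - k = 0 then 1 else 0))"
      by (intro specialises_mult specialises_inverse_v0 specialises_seq)
    with 1 assms show ?thesis
      by (auto simp: X_index X1_on_def partner1_def split: if_splits)
  next
    case 2
    with assms show ?thesis
      by (auto simp: X_index X1_on_def partner1_def intro: specialises_0 specialises_1)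
  next
    case 3
    let ?d = "\<lambda>j. if k = j then 1 else 0"
    have "specialises c (?d (i - 1) - m1 * ?d i) (?d (i - 1) - 0 * ?d i)"
      by (intro specialises_diff specialises_mult[OF specialises_m1] specialises_indicator)
    with 3 assms show ?thesis
      by (auto simp: X_index X1_on_def partner1_def)
  qed
qed

section \<open>Invertibility\<close>

lemma det_nonzeroI:
  assumes "A \<in> carrier_mat n n"
    and "\<And>i j. i < n \<Longrightarrow> j < n \<Longrightarrow> specialises c (A $$ (i, j)) (g i j)"
    and "det (mat n n (\<lambda>(i, j). g i j)) \<noteq> 0"
  shows "det A \<noteq> 0"
proof -
  have "A = mat n n (\<lambda>(i, j). A $$ (i, j))"
    using assms(1) by auto
  with specialises_det[of n c "\<lambda>i j. A $$ (i, j)" g] assms(2,3) show ?thesis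
    using specialises_zeroD by metis
qed

lemma det_involution_nonzero:
  fixes p :: "nat \<Rightarrow> nat"
  assumes "\<And>i. i < n \<Longrightarrow> p i < n" "\<And>i. i < n \<Longrightarrow> p (p i) = i"
  shows "det (mat n n (\<lambda>(i, j). if i = p j then 1 else 0 :: 'a :: idom)) \<noteq> 0"
proof -
  let ?P = "mat n n (\<lambda>(i, j). if i = p j then 1 else 0 :: 'a)"
  have "?P * ?P = 1\<^sub>m n"
  proof (rule eq_matI)
    fix i j assume ij: "i < dim_row (1\<^sub>m n)" "j < dim_col (1\<^sub>m n)"
    then have "(?P * ?P) $$ (i, j) = (\<Sum>k = 0..<n. (if i = p k then 1 else 0) * (if k = p j then 1 else 0))"
      by (simp add: scalar_prod_def)
    also have "\<dots> = (if i = p (p j) then 1 else 0)"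
      using ij assms(1)[of j] by (simp add: if_distrib[of "\<lambda>x. _ * x"] cong: if_cong)
    also have "\<dots> = 1\<^sub>m n $$ (i, j)"
      using ij assms(2)[of j] by simp
    finally show "(?P * ?P) $$ (i, j) = 1\<^sub>m n $$ (i, j)" .
  qed auto
  then have "det ?P * det ?P = 1"
    by (metis det_mult det_one mat_carrier)
  then show ?thesis by auto
qed

lemma det_X_nonzero: "det (X0 n) \<noteq> 0" "det (X1 n) \<noteq> 0"
proof -
  \<comment> \<open>At \<open>l\<^sub>0 = 1\<close> the factor at \<open>u\<^sub>0\<close> disappears and a permutation matrix is left.\<close>
  show "det (X0 n) \<noteq> 0"
  proof (rule det_nonzeroI[OF X_carrier(1)])
    show "specialises 1 (X0 n $$ (k, i)) (if k = partner0 n i then 1 else 0)"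
      if "k < n" "i < n" for k i
      using specialises_X0[OF that, of 1] by (auto split: if_splits)
  qed (intro det_involution_nonzero partner_involution)
  show "det (X1 n) \<noteq> 0"
  proof (rule det_nonzeroI[OF X_carrier(2)])
    show "specialises 0 (X1 n $$ (k, i)) (if k = partner1 n i then 1 else 0)"
      if "k < n" "i < n" for k i
      using specialises_X1[OF that] .
  qed (intro det_involution_nonzero partner_involution)
qed

lemma invertible_mat_if_det_nonzero:
  fixes A :: "'a :: field mat"
  assumes A: "A \<in> carrier_mat n n" and "det A \<noteq> 0"
  shows "invertible_mat A"
proof -
  from det_non_zero_imp_unit[OF assms] obtain B
    where "B \<in> carrier_mat n n" "A * B = 1\<^sub>m n" "B * A = 1\<^sub>m n"
    by (auto simp: Units_def ring_mat_def)
  with A show ?thesis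
    by (auto simp: invertible_mat_def inverts_mat_def)
qed

section \<open>Irreducibility\<close>

text \<open>Up to the factor \<open>- m\<^sub>0 l\<^sub>0\<close>, the coefficient vectors of the functionals
  \<open>\<phi>\<close>, \<open>\<phi> X\<^sub>1\<close>, \<open>\<phi> X\<^sub>1 X\<^sub>0\<close>, \<dots>, where \<open>\<phi>\<close> is the zeroth row of \<open>E\<^sub>0\<close>. The factor removes the poles of
  \<open>\<tau>\<^sub>0\<close> and \<open>\<lambda>\<^sub>k\<close> and turns \<open>\<tau>\<^sub>0\<close> into \<open>1 - l\<^sub>0\<^sup>2 - m\<^sub>0 l\<^sub>0\<close>, which specialises to \<open>1\<close> at \<open>l\<^sub>0 = 0\<close>.\<close>

fun probe :: "nat \<Rightarrow> nat \<Rightarrow> FLambda vec" where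
  "probe n 0 = vec n (\<lambda>i. - (m0 * l0) * E0 n $$ (0, i))"
| "probe n (Suc j) = (if even j then X1 n else X0 n)\<^sup>T *\<^sub>v probe n j"

lemma probe_carrier [simp]: "probe n j \<in> carrier_vec n"
  by (induction j) (auto intro: carrier_vecI)

lemmas dim_probe [simp] = probe_carrier [THEN carrier_vecD]

text \<open>The point \<open>l\<^sub>0 = 0\<close> is chosen so that \<open>\<phi>\<close> itself degenerates to the coordinate of \<open>u\<^sub>0\<close>. In the
  inductive step, the coordinate of \<open>u\<^sub>j\<close> composed with the degenerate operator is the coordinate of
  the partner of \<open>j\<close>, which is \<open>j + 1\<close> for \<open>X\<^sub>1\<close> if \<open>j\<close> is even and for \<open>X\<^sub>0\<close> if \<open>j\<close> is odd.\<close>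

lemma specialises_probe:
  assumes "i < n" "j < n"
  shows "specialises 0 (probe n j $ i) (if i = j then 1 else 0)"
  using assms
proof (induction j arbitrary: i)
  case 0
  consider "i = 0" | "odd i" | "even i" "i \<noteq> 0" by blast
  then show ?case
  proof cases
    case 1
    have "specialises 0 (1 - l0 * l0 - m0 * l0) (1 - 0 * 0 - 0 * 0)"
      by (intro specialises_diff specialises_1 specialises_mult specialises_l0 specialises_m0)
    moreover have "- (m0 * l0) * tau0 = 1 - l0 * l0 - m0 * l0"
      using m0_nonzero l0_nonzero by (simp add: tau0_def field_simps)
    ultimately show ?thesis
      using 0 1 by (simp add: X_index E0_on_def)
  next
    case 2
    with 0 show ?thesis
      using specialises_minus[OF specialises_m0_l0_lam[of 0 i]]
      by (auto simp: X_index E0_on_def)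
  next
    case 3
    with 0 show ?thesis
      using specialises_minus[OF specialises_mult[OF specialises_l0[of 0] specialises_m0_l0_lam[of 0 "i - 1"]]]
      by (simp add: X_index E0_on_def mult_ac)
  qed
next
  case (Suc j)
  define A where "A = (if even j then X1 n else X0 n)"
  have A: "A \<in> carrier_mat n n"
    by (simp add: A_def)
  have entry: "specialises 0 (A $$ (j, i)) (if i = Suc j then 1 else 0)"
    using specialises_X0[of j n i 0] specialises_X1[of j n i 0] Suc.prems
    by (cases "i = 0") (auto simp: A_def partner0_def partner1_def split: if_splits)
  \<comment> \<open>The remaining entries of the column meet zero coordinates, so it suffices that they have a value.\<close>
  have "\<exists>q. specialises 0 (A $$ (k, i)) q" if "k < n" for k
    using specialises_X0[of k n i 0] specialises_X1[of k n i 0] Suc.prems that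
    by (auto simp: A_def)
  then obtain q where q: "specialises 0 (A $$ (k, i)) (q k)" if "k < n" for k
    by metis
  have "specialises 0 (\<Sum>k = 0..<n. A $$ (k, i) * probe n j $ k)
      (\<Sum>k = 0..<n. (if k = j then if i = Suc j then 1 else 0 else q k) * (if k = j then 1 else 0))"
    using Suc q entry by (intro specialises_sum specialises_mult) auto
  also have "(\<Sum>k = 0..<n. A $$ (k, i) * probe n j $ k) = probe n (Suc j) $ i"
    using Suc.prems A by (simp add: A_def[symmetric] scalar_prod_def)
  also have "(\<Sum>k = 0..<n. (if k = j then if i = Suc j then 1 else 0 else q k) * (if k = j then 1 else 0))
      = (if i = Suc j then 1 else 0)"
    using Suc.prems by (simp add: if_distrib cong: if_cong)
  finally show ?case .
qed

text \<open>The matrix whose rows are the functionals specialises to the identity, hence its determinant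
  is nonzero.\<close>

lemma probes_separate:
  assumes w: "w \<in> carrier_vec n" and zero: "\<And>j. j < n \<Longrightarrow> probe n j \<bullet> w = 0"
  shows "w = 0\<^sub>v n"
proof -
  let ?D = "mat n n (\<lambda>(j, i). probe n j $ i)"
  have "det ?D \<noteq> 0"
  proof (rule det_nonzeroI)
    show "specialises 0 (?D $$ (j, i)) (if i = j then 1 else 0)" if "j < n" "i < n" for j i
      using specialises_probe[OF that(2,1)] that by simp
    have "mat n n (\<lambda>(j, i). if i = j then 1 else 0 :: rat) = 1\<^sub>m n"
      by auto
    then show "det (mat n n (\<lambda>(j, i). if i = j then 1 else 0 :: rat)) \<noteq> 0"
      by simp
  qed simp
  moreover have "?D *\<^sub>v w = 0\<^sub>v n"
  proof (rule eq_vecI)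
    fix j assume "j < dim_vec (0\<^sub>v n)"
    moreover from this have "row ?D j = probe n j"
      by (intro eq_vecI) auto
    ultimately show "(?D *\<^sub>v w) $ j = 0\<^sub>v n $ j"
      using zero by simp
  qed simp
  ultimately show ?thesis
    using w by (auto simp: det_0_iff_vec_prod_zero_field[of ?D n])
qed

lemma probe_zero_on_invariant:
  assumes W: "W \<subseteq> carrier_vec n"
    and inv: "\<And>w. w \<in> W \<Longrightarrow> X0 n *\<^sub>v w \<in> W" "\<And>w. w \<in> W \<Longrightarrow> X1 n *\<^sub>v w \<in> W"
    and zero: "\<And>w. w \<in> W \<Longrightarrow> probe n 0 \<bullet> w = 0"
    and "w \<in> W"
  shows "probe n j \<bullet> w = 0"
  using \<open>w \<in> W\<close>
proof (induction j arbitrary: w)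
  case (Suc j)
  define A where "A = (if even j then X1 n else X0 n)"
  have "probe n (Suc j) \<bullet> w = probe n j \<bullet> (A *\<^sub>v w)"
    using Suc.prems W transpose_vec_mult_scalar[of A n n w "probe n j"]
    by (auto simp: A_def)
  also have "\<dots> = 0"
    using Suc inv by (simp add: A_def)
  finally show ?case .
qed (rule zero)

lemma E0_mult_vec:
  assumes w: "w \<in> carrier_vec n" and "0 < n"
  shows "E0 n *\<^sub>v w = (row (E0 n) 0 \<bullet> w) \<cdot>\<^sub>v unit_vec n 0"
proof (rule eq_vecI)
  fix k assume k: "k < dim_vec ((row (E0 n) 0 \<bullet> w) \<cdot>\<^sub>v unit_vec n 0)"
  have "row (E0 n) k = 0\<^sub>v n" if "k \<noteq> 0"
    using that k X_carrier(3)[of n] by (intro eq_vecI) (auto simp: X_index E0_on_def)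
  with k w \<open>0 < n\<close> show "(E0 n *\<^sub>v w) $ k = ((row (E0 n) 0 \<bullet> w) \<cdot>\<^sub>v unit_vec n 0) $ k"
    using X_carrier(3)[of n] by (cases "k = 0") auto
qed (use X_carrier(3)[of n] in auto)

lemma probe_0_eq:
  assumes "w \<in> carrier_vec n" "0 < n"
  shows "probe n 0 \<bullet> w = - (m0 * l0) * (row (E0 n) 0 \<bullet> w)"
proof -
  have "probe n 0 = - (m0 * l0) \<cdot>\<^sub>v row (E0 n) 0"
    using X_carrier(3)[of n] assms by (intro eq_vecI) auto
  with assms show ?thesis
    by (simp add: row_carrier_vec[OF _ X_carrier(3)])
qed

text \<open>\<open>X\<^sub>1 u\<^sub>j = u\<^sub>j\<^sub>+\<^sub>1\<close> for even \<open>j < n - 1\<close> and \<open>X\<^sub>0 u\<^sub>j = u\<^sub>j\<^sub>+\<^sub>1\<close> for odd \<open>j < n - 1\<close>: the special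
  columns are only those of the last basis vector.\<close>

lemma unit_vec_in_invariant:
  assumes inv: "\<And>w. w \<in> W \<Longrightarrow> X0 n *\<^sub>v w \<in> W" "\<And>w. w \<in> W \<Longrightarrow> X1 n *\<^sub>v w \<in> W"
    and "unit_vec n 0 \<in> W" "j < n"
  shows "unit_vec n j \<in> W"
  using \<open>j < n\<close>
proof (induction j)
  case 0
  show ?case by fact
next
  case (Suc j)
  define A where "A = (if even j then X1 n else X0 n)"
  have "A *\<^sub>v unit_vec n j = unit_vec n (Suc j)"
    using Suc.prems X_carrier[of n]
    by (intro eq_vecI) (auto simp: A_def X_index X0_on_def X1_on_def odd_pos)
  with Suc inv(1)[of "unit_vec n j"] inv(2)[of "unit_vec n j"] show ?case
    by (auto simp: A_def split: if_splits)
qed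

lemma subspace_vecD:
  fixes W :: "'a :: field vec set"
  assumes "subspace class_ring W (module_vec TYPE('a) n)"
  shows "W \<subseteq> carrier_vec n" "0\<^sub>v n \<in> W"
    and "\<And>v w. v \<in> W \<Longrightarrow> w \<in> W \<Longrightarrow> v + w \<in> W"
    and "\<And>c w. w \<in> W \<Longrightarrow> c \<cdot>\<^sub>v w \<in> W"
proof -
  have sub: "submodule class_ring W (module_vec TYPE('a) n)"
    using assms by (simp add: VectorSpace.subspace_def)
  show "W \<subseteq> carrier_vec n" "0\<^sub>v n \<in> W"
    using submodule.subset[OF sub] submodule.zero_closed[OF sub] by (simp_all add: module_vec_simps)
  show "\<And>v w. v \<in> W \<Longrightarrow> w \<in> W \<Longrightarrow> v + w \<in> W"
    using submodule.m_closed[OF sub] by (simp add: module_vec_simps)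
  show "\<And>c w. w \<in> W \<Longrightarrow> c \<cdot>\<^sub>v w \<in> W"
    using submodule.smult_closed[OF sub] by (simp add: module_vec_simps)
qed

lemma subspace_eq_carrier_vec:
  fixes W :: "'a :: field vec set"
  assumes W: "subspace class_ring W (module_vec TYPE('a) n)"
    and units: "\<And>j. j < n \<Longrightarrow> unit_vec n j \<in> W"
  shows "W = carrier_vec n"
proof
  show "W \<subseteq> carrier_vec n"
    by (rule subspace_vecD[OF W])
  show "carrier_vec n \<subseteq> W"
  proof
    fix w :: "'a vec" assume w: "w \<in> carrier_vec n"
    \<comment> \<open>The partial sums of \<open>\<Sum>i<n. w\<^sub>i u\<^sub>i\<close> lie in \<open>W\<close>.\<close>
    have "vec n (\<lambda>i. if i < k then w $ i else 0) \<in> W" if "k \<le> n" for k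
      using that
    proof (induction k)
      case 0
      have "vec n (\<lambda>i. if i < 0 then w $ i else 0) = 0\<^sub>v n" by auto
      then show ?case using subspace_vecD(2)[OF W] by simp
    next
      case (Suc k)
      have "vec n (\<lambda>i. if i < Suc k then w $ i else 0)
          = vec n (\<lambda>i. if i < k then w $ i else 0) + w $ k \<cdot>\<^sub>v unit_vec n k"
        using Suc.prems by (intro eq_vecI) (auto simp: less_Suc_eq)
      with Suc units[of k] show ?case
        using subspace_vecD(3,4)[OF W] by simp
    qed
    moreover have "vec n (\<lambda>i. if i < n then w $ i else 0) = w"
      using w by (intro eq_vecI) auto
    ultimately show "w \<in> W"
      by (metis order_refl)
  qed
qed

lemma irreducible_rho_LK:
  assumes "0 < n"
  shows "irreducible_under n (rho_LK n)"
  unfolding irreducible_under_def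
proof (rule notI, elim exE conjE)
  fix W
  assume W: "subspace class_ring W (module_vec TYPE(FLambda) n)"
    and nonzero: "W \<noteq> {0\<^sub>v n}" and proper: "W \<noteq> carrier_vec n"
    and stable: "\<forall>A\<in>rho_LK n. \<forall>w\<in>W. A *\<^sub>v w \<in> W"
  have inv: "\<And>w. w \<in> W \<Longrightarrow> X0 n *\<^sub>v w \<in> W" "\<And>w. w \<in> W \<Longrightarrow> X1 n *\<^sub>v w \<in> W"
      "\<And>w. w \<in> W \<Longrightarrow> E0 n *\<^sub>v w \<in> W"
    using stable unfolding rho_LK_def by blast+
  note W_vec = subspace_vecD(1)[OF W]
  have "row (E0 n) 0 \<bullet> w = 0" if "w \<in> W" for w
  proof (rule ccontr)
    let ?s = "row (E0 n) 0 \<bullet> w"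
    assume "?s \<noteq> 0"
    have "?s \<cdot>\<^sub>v unit_vec n 0 \<in> W"
      using inv(3)[OF that] E0_mult_vec[OF _ \<open>0 < n\<close>] that W_vec by auto
    then have "inverse ?s \<cdot>\<^sub>v (?s \<cdot>\<^sub>v unit_vec n 0) \<in> W"
      by (rule subspace_vecD(4)[OF W])
    with \<open>?s \<noteq> 0\<close> have "unit_vec n 0 \<in> W"
      by (simp add: smult_smult_assoc)
    then have "W = carrier_vec n"
      using unit_vec_in_invariant[OF inv(1,2)] by (intro subspace_eq_carrier_vec[OF W])
    with proper show False ..
  qed
  then have "probe n 0 \<bullet> w = 0" if "w \<in> W" for w
    using that W_vec probe_0_eq[OF _ \<open>0 < n\<close>, of w] by auto
  then have "probe n j \<bullet> w = 0" if "w \<in> W" for j w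
    using probe_zero_on_invariant[OF W_vec inv(1,2)] that by blast
  then have "w = 0\<^sub>v n" if "w \<in> W" for w
    using probes_separate that W_vec by blast
  with nonzero subspace_vecD(2)[OF W] show False
    by blast
qed

theorem theorem6p3:
  fixes n :: nat
  assumes "n \<ge> 2"
  shows "invertible_mat (X0 n) \<and> invertible_mat (X1 n) \<and> irreducible_under n (rho_LK n)"
  using assms invertible_mat_if_det_nonzero[OF X_carrier(1) det_X_nonzero(1)]
    invertible_mat_if_det_nonzero[OF X_carrier(2) det_X_nonzero(2)] irreducible_rho_LK[of n]
  by simp

end
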